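(* For every $n,s \in \mathbb{N}$ and every $\bm{k}=(k_1,\ldots,k_s) \in \mathbb{N}^s$, at least one of the $\bm{k}$-extremal graphs of order $n$ is complete multipartite. That is, there is a complete multipartite graph $G$ on $n$ vertices with $F(G;\bm{k}) = F(n;\bm{k})$.
   Context: For $s\in\mathbb{N}$ write $[s]=\{1,\dots,s\}$. An $s$-edge-colouring of a graph $G=(V,E)$ is any function $\sigma:E\to[s]$ (not necessarily proper). Given $\bm{k}=(k_1,\dots,k_s)\in\mathbb{N}^s$, a colouring $\sigma$ is $\bm{k}$-valid if for every $c\in[s]$ the subgraph formed by the edges of colour $c$, $\sigma^{-1}(c)$, contains no copy of the complete graph $K_{k_c}$. $F(G;\bm{k})$ denotes the number of $\bm{k}$-valid $s$-edge-colourings of $G$, and $F(n;\bm{k})$ denotes the maximum of $F(G;\bm{k})$ over all graphs $G$ on $n$ vertices. A graph $G$ on $n$ vertices is $\bm{k}$-extremal if $F(G;\bm{k})=F(n;\bm{k})$. *)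

theory Defs
  imports "HOL-Library.FuncSet" "HOL-Library.Disjoint_Sets" "HOL-Library.Ramsey"
begin

text \<open>A finite simple graph is given by its vertex set \<open>V\<close> and its set \<open>E\<close> of edges, each edge
  being a two-element subset of \<open>V\<close>.\<close>

definition simple_graph :: "'a set \<Rightarrow> 'a set set \<Rightarrow> bool" where
  "simple_graph V E \<longleftrightarrow> finite V \<and> E \<subseteq> nsets V 2"

definition contains_complete :: "'a set \<Rightarrow> 'a set set \<Rightarrow> nat \<Rightarrow> bool" where
  "contains_complete V E r \<longleftrightarrow> (\<exists>S \<in> nsets V r. clique S E)"

definition edge_colourings :: "'a set set \<Rightarrow> nat \<Rightarrow> ('a set \<Rightarrow> nat) set" where
  "edge_colourings E s = E \<rightarrow>\<^sub>E {1..s}"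

text \<open>A vector \<open>(k\<^sub>1, \<dots>, k\<^sub>s)\<close> is a function \<open>k\<close> of which only the values on \<open>{1..s}\<close> are used.
  The subgraph of colour \<open>c\<close> is the spanning subgraph of \<open>(V, E)\<close> with edge set \<open>\<sigma>\<^sup>-\<^sup>1(c)\<close>.\<close>

definition valid_colouring ::
    "'a set \<Rightarrow> 'a set set \<Rightarrow> nat \<Rightarrow> (nat \<Rightarrow> nat) \<Rightarrow> ('a set \<Rightarrow> nat) \<Rightarrow> bool" where
  "valid_colouring V E s k \<sigma> \<longleftrightarrow>
     (\<forall>c \<in> {1..s}. \<not> contains_complete V {e \<in> E. \<sigma> e = c} (k c))"

definition num_valid :: "'a set \<Rightarrow> 'a set set \<Rightarrow> nat \<Rightarrow> (nat \<Rightarrow> nat) \<Rightarrow> nat" where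
  "num_valid V E s k = card {\<sigma> \<in> edge_colourings E s. valid_colouring V E s k \<sigma>}"

text \<open>Every graph on \<open>n\<close> vertices is isomorphic to one whose vertices are natural numbers, so the
  maximum over all graphs of order \<open>n\<close> is taken over these.\<close>

definition num_valid_values :: "nat \<Rightarrow> nat \<Rightarrow> (nat \<Rightarrow> nat) \<Rightarrow> nat set" where
  "num_valid_values n s k =
     {num_valid V E s k | (V :: nat set) E. simple_graph V E \<and> card V = n}"

definition max_num_valid :: "nat \<Rightarrow> nat \<Rightarrow> (nat \<Rightarrow> nat) \<Rightarrow> nat" where
  "max_num_valid n s k = Max (num_valid_values n s k)"

text \<open>The maximum is taken over a finite nonempty set, hence is attained.\<close>

lemma finite_num_valid_values: "finite (num_valid_values n s k)"
proof -
  have "num_valid V E s k \<le> Suc s ^ (n choose 2)"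
    if g: "simple_graph V E" and n: "card V = n" for V :: "nat set" and E
  proof -
    have V: "finite V" and E: "E \<subseteq> nsets V 2"
      using g by (auto simp: simple_graph_def)
    have fN: "finite (nsets V 2)" using V by (rule finite_imp_finite_nsets)
    then have fE: "finite E" using E finite_subset by blast
    have cE: "card E \<le> n choose 2"
      using card_mono[OF fN E] n V by simp
    have "num_valid V E s k \<le> card (edge_colourings E s)"
      unfolding num_valid_def edge_colourings_def
      by (intro card_mono finite_PiE fE) auto
    also have "\<dots> = s ^ card E"
      by (simp add: edge_colourings_def card_PiE fE)
    also have "\<dots> \<le> Suc s ^ card E" by (rule power_mono) auto
    also have "\<dots> \<le> Suc s ^ (n choose 2)" using cE by (rule power_increasing) simp
    finally show ?thesis .
  qed
  then have "num_valid_values n s k \<subseteq> {..Suc s ^ (n choose 2)}"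
    unfolding num_valid_values_def by blast
  then show ?thesis by (rule finite_subset) simp
qed

lemma num_valid_values_nonempty: "num_valid_values n s k \<noteq> {}"
proof -
  have "simple_graph {..<n} ({} :: nat set set)" and "card {..<n} = n"
    by (auto simp: simple_graph_def)
  then show ?thesis unfolding num_valid_values_def by blast
qed

definition extremal :: "nat \<Rightarrow> nat \<Rightarrow> (nat \<Rightarrow> nat) \<Rightarrow> 'a set \<Rightarrow> 'a set set \<Rightarrow> bool" where
  "extremal n s k V E \<longleftrightarrow>
     simple_graph V E \<and> card V = n \<and> num_valid V E s k = max_num_valid n s k"

text \<open>Parts are nonempty but any number of them is allowed; in particular edgeless and complete
  graphs are complete multipartite.\<close>

definition complete_multipartite :: "'a set \<Rightarrow> 'a set set \<Rightarrow> bool" where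
  "complete_multipartite V E \<longleftrightarrow>
     (\<exists>P. partition_on V P \<and>
          E = {{u, v} | u v. \<exists>A \<in> P. \<exists>B \<in> P. A \<noteq> B \<and> u \<in> A \<and> v \<in> B})"

end

(* Zykov symmetrisation.  For non-adjacent u and v, no monochromatic clique meets both, so the
   number of valid colourings is the sum, over the colourings of the edges avoiding u and v, of the
   product a * b of the numbers of extensions to the edges at u and at v.  Replacing v by a twin
   of u turns a * b into a * a, and since 2ab <= a^2 + b^2, cloning either vertex of a
   non-adjacent pair of an extremal graph gives an extremal graph.  Cloning the vertex whose twin
   class is not the smaller one increases the number of pairs of twins; so in an extremal graph
   with the most such pairs non-adjacent vertices are twins, and the graph is complete
   multipartite. *)

theory Submission
  imports Defs "HOL-Combinatorics.Transposition"
begin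

section \<open>Counting colourings\<close>

lemma contains_complete_mono:
  assumes "contains_complete V E r" and "E \<subseteq> E'"
  shows "contains_complete V E' r"
  using assms(1) subsetD[OF assms(2)] unfolding contains_complete_def clique_def by metis

lemma contains_complete_bij_image:
  assumes p: "bij_betw p V V" and c: "contains_complete V E r"
  shows "contains_complete V ((`) p ` E) r"
proof -
  obtain S where S: "S \<in> nsets V r" "clique S E"
    using c unfolding contains_complete_def by blast
  have SV: "S \<subseteq> V" "finite S" "card S = r" using S(1) by (auto simp: nsets_def)
  have inj: "inj_on p S" using p SV(1) by (meson bij_betw_def inj_on_subset)
  have "p ` S \<in> nsets V r"
    using SV p inj by (auto simp: nsets_def card_image bij_betw_def)
  moreover have "clique (p ` S) ((`) p ` E)"
    unfolding clique_def
  proof (intro ballI impI)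
    fix x y assume "x \<in> p ` S" "y \<in> p ` S" "x \<noteq> y"
    then obtain a b where ab: "a \<in> S" "b \<in> S" "x = p a" "y = p b" "a \<noteq> b" by blast
    then have "{a, b} \<in> E" using S(2) by (auto simp: clique_def)
    then have "p ` {a, b} \<in> (`) p ` E" by (rule imageI)
    then show "{x, y} \<in> (`) p ` E" using ab by simp
  qed
  ultimately show ?thesis unfolding contains_complete_def by blast
qed

lemma valid_colouring_cong:
  assumes "\<And>e. e \<in> E \<Longrightarrow> \<sigma> e = \<tau> e"
  shows "valid_colouring V E s k \<sigma> \<longleftrightarrow> valid_colouring V E s k \<tau>"
proof -
  have "{e \<in> E. \<sigma> e = c} = {e \<in> E. \<tau> e = c}" for c using assms by auto
  then show ?thesis by (simp add: valid_colouring_def)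
qed

lemma valid_colouring_subset:
  assumes "valid_colouring V E s k \<sigma>" and "E' \<subseteq> E"
  shows "valid_colouring V E' s k \<sigma>"
  unfolding valid_colouring_def
proof (intro ballI notI)
  fix c assume c: "c \<in> {1..s}" "contains_complete V {e \<in> E'. \<sigma> e = c} (k c)"
  have "{e \<in> E'. \<sigma> e = c} \<subseteq> {e \<in> E. \<sigma> e = c}" using assms(2) by auto
  with c contains_complete_mono assms(1) show False unfolding valid_colouring_def by blast
qed

text \<open>A clique cannot contain both of the non-adjacent vertices \<open>u\<close> and
  \<open>v\<close>. If it misses \<open>v\<close>, all its edges lie in \<open>E1\<close>; if it
  misses \<open>u\<close>, they lie in \<open>E2\<close>. So validity can be tested on the two edge
  sets separately, which is what makes the counts multiply.\<close>

lemma valid_colouring_split: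
  assumes "u \<noteq> v" and "{u, v} \<notin> E"
    and E1: "\<And>e. e \<in> E \<Longrightarrow> v \<notin> e \<Longrightarrow> e \<in> E1" and E2: "\<And>e. e \<in> E \<Longrightarrow> u \<notin> e \<Longrightarrow> e \<in> E2"
    and v1: "valid_colouring V E1 s k \<sigma>" and v2: "valid_colouring V E2 s k \<sigma>"
  shows "valid_colouring V E s k \<sigma>"
  unfolding valid_colouring_def
proof (intro ballI notI)
  fix c assume c: "c \<in> {1..s}" "contains_complete V {e \<in> E. \<sigma> e = c} (k c)"
  then obtain S where S: "S \<in> nsets V (k c)" "clique S {e \<in> E. \<sigma> e = c}"
    unfolding contains_complete_def by blast
  consider "v \<notin> S" | "u \<notin> S" using S(2) assms(1,2) by (auto simp: clique_def)
  then have "clique S {e \<in> E1. \<sigma> e = c} \<or> clique S {e \<in> E2. \<sigma> e = c}"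
  proof cases
    case 1
    then have "clique S {e \<in> E1. \<sigma> e = c}"
      using S(2) E1 unfolding clique_def by blast
    then show ?thesis ..
  next
    case 2
    then have "clique S {e \<in> E2. \<sigma> e = c}"
      using S(2) E2 unfolding clique_def by blast
    then show ?thesis ..
  qed
  then show False
    using S(1) c(1) v1 v2 unfolding valid_colouring_def contains_complete_def by blast
qed

section \<open>Extending a colouring to further edges\<close>

text \<open>In the application \<open>D\<close> is the set of edges avoiding two non-adjacent
  vertices, and \<open>A\<close> consists of edges at one or both of them.\<close>

definition extensions ::
    "'a set \<Rightarrow> 'a set set \<Rightarrow> 'a set set \<Rightarrow> nat \<Rightarrow> (nat \<Rightarrow> nat) \<Rightarrow> ('a set \<Rightarrow> nat) \<Rightarrow> ('a set \<Rightarrow> nat) set"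
  where "extensions V D A s k \<tau> =
    {\<sigma> \<in> edge_colourings (D \<union> A) s. valid_colouring V (D \<union> A) s k \<sigma> \<and> restrict \<sigma> D = \<tau>}"

text \<open>A colouring of \<open>D \<union> (A \<union> B)\<close> amounts to a pair of colourings
  of \<open>D \<union> A\<close> and \<open>D \<union> B\<close> that agree on \<open>D\<close>.
  Restriction preserves validity; gluing does so by \<open>valid_colouring_split\<close>, as
  \<open>D \<union> A\<close> holds every edge missing \<open>v\<close> and
  \<open>D \<union> B\<close> every edge missing \<open>u\<close>.\<close>

lemma card_extensions_union:
  assumes "u \<noteq> v"
    and D: "\<And>e. e \<in> D \<Longrightarrow> u \<notin> e \<and> v \<notin> e"
    and A: "\<And>e. e \<in> A \<Longrightarrow> u \<in> e \<and> v \<notin> e" and B: "\<And>e. e \<in> B \<Longrightarrow> v \<in> e \<and> u \<notin> e"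
  shows "card (extensions V D (A \<union> B) s k \<tau>) =
    card (extensions V D A s k \<tau>) * card (extensions V D B s k \<tau>)"
proof -
  let ?f = "\<lambda>\<sigma>. (restrict \<sigma> (D \<union> A), restrict \<sigma> (D \<union> B))"
  \<comment> \<open>Both components restrict to \<open>\<tau>\<close> on \<open>D\<close>, so taking
    the values of \<open>\<alpha>\<close> there is no loss; the outer \<open>restrict\<close> makes
    the glued map extensional.\<close>
  let ?g = "\<lambda>(\<alpha>, \<beta>). restrict (\<lambda>e. if e \<in> B then \<beta> e else \<alpha> e) (D \<union> (A \<union> B))"
  have disj: "D \<inter> A = {}" "D \<inter> B = {}" "A \<inter> B = {}" using D A B by blast+
  have "bij_betw ?f (extensions V D (A \<union> B) s k \<tau>)
      (extensions V D A s k \<tau> \<times> extensions V D B s k \<tau>)"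
  proof (rule bij_betw_byWitness[where f' = ?g])
    show "\<forall>\<sigma> \<in> extensions V D (A \<union> B) s k \<tau>. ?g (?f \<sigma>) = \<sigma>"
    proof
      fix \<sigma> assume "\<sigma> \<in> extensions V D (A \<union> B) s k \<tau>"
      then have "\<sigma> \<in> extensional (D \<union> (A \<union> B))"
        by (auto simp: extensions_def edge_colourings_def PiE_def)
      then show "?g (?f \<sigma>) = \<sigma>"
        by (auto simp: fun_eq_iff restrict_def extensional_def)
    qed
    show "\<forall>p \<in> extensions V D A s k \<tau> \<times> extensions V D B s k \<tau>. ?f (?g p) = p"
    proof
      fix p assume "p \<in> extensions V D A s k \<tau> \<times> extensions V D B s k \<tau>"
      then obtain \<alpha> \<beta> where p: "p = (\<alpha>, \<beta>)"
        and a: "\<alpha> \<in> extensional (D \<union> A)" "restrict \<alpha> D = \<tau>"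
        and b: "\<beta> \<in> extensional (D \<union> B)" "restrict \<beta> D = \<tau>"
        by (auto simp: extensions_def edge_colourings_def PiE_def)
      have ab: "\<alpha> e = \<beta> e" if "e \<in> D" for e
        using a(2) b(2) that by (metis restrict_apply')
      have "restrict (?g p) (D \<union> A) = \<alpha>"
        using a(1) disj p by (auto simp: fun_eq_iff restrict_def extensional_def)
      moreover have "restrict (?g p) (D \<union> B) = \<beta>"
        using b(1) disj p ab by (auto simp: fun_eq_iff restrict_def extensional_def)
      ultimately show "?f (?g p) = p" using p by simp
    qed
    show "?f ` extensions V D (A \<union> B) s k \<tau> \<subseteq> extensions V D A s k \<tau> \<times> extensions V D B s k \<tau>"
    proof (rule image_subsetI)
      fix \<sigma> assume s: "\<sigma> \<in> extensions V D (A \<union> B) s k \<tau>"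
      have "restrict \<sigma> (D \<union> C) \<in> extensions V D C s k \<tau>" if "C \<subseteq> A \<union> B" for C
      proof -
        have "valid_colouring V (D \<union> C) s k \<sigma>"
          using s that by (auto simp: extensions_def elim: valid_colouring_subset)
        then have "valid_colouring V (D \<union> C) s k (restrict \<sigma> (D \<union> C))"
          by (subst valid_colouring_cong[of _ _ \<sigma>]) auto
        moreover have "restrict \<sigma> (D \<union> C) \<in> edge_colourings (D \<union> C) s"
          using s that by (auto simp: extensions_def edge_colourings_def PiE_def Pi_def)
        moreover have "restrict (restrict \<sigma> (D \<union> C)) D = \<tau>"
          using s by (auto simp: extensions_def Int_absorb1)
        ultimately show ?thesis by (simp add: extensions_def)
      qed
      then show "?f \<sigma> \<in> extensions V D A s k \<tau> \<times> extensions V D B s k \<tau>" by simp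
    qed
    show "?g ` (extensions V D A s k \<tau> \<times> extensions V D B s k \<tau>) \<subseteq> extensions V D (A \<union> B) s k \<tau>"
    proof (rule image_subsetI)
      fix p assume "p \<in> extensions V D A s k \<tau> \<times> extensions V D B s k \<tau>"
      then obtain \<alpha> \<beta> where p: "p = (\<alpha>, \<beta>)"
        and a: "\<alpha> \<in> edge_colourings (D \<union> A) s" "valid_colouring V (D \<union> A) s k \<alpha>" "restrict \<alpha> D = \<tau>"
        and b: "\<beta> \<in> edge_colourings (D \<union> B) s" "valid_colouring V (D \<union> B) s k \<beta>" "restrict \<beta> D = \<tau>"
        by (auto simp: extensions_def)
      have ab: "\<alpha> e = \<beta> e" if "e \<in> D" for e
        using a(3) b(3) that by (metis restrict_apply')
      define \<gamma> where "\<gamma> = ?g p"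
      have ga: "\<gamma> e = \<alpha> e" if "e \<in> D \<union> A" for e using that disj p by (auto simp: \<gamma>_def)
      have gb: "\<gamma> e = \<beta> e" if "e \<in> D \<union> B" for e using that disj p ab by (auto simp: \<gamma>_def)
      have "valid_colouring V (D \<union> (A \<union> B)) s k (\<gamma>)"
      proof (rule valid_colouring_split[OF assms(1)])
        show "{u, v} \<notin> D \<union> (A \<union> B)" using D A B by blast
        show "valid_colouring V (D \<union> A) s k (\<gamma>)"
          by (subst valid_colouring_cong[of _ _ \<alpha>]) (simp_all add: ga a(2))
        show "valid_colouring V (D \<union> B) s k (\<gamma>)"
          by (subst valid_colouring_cong[of _ _ \<beta>]) (simp_all add: gb b(2))
      qed (use A B in blast)+
      moreover have "\<gamma> \<in> edge_colourings (D \<union> (A \<union> B)) s"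
        using a(1) b(1) p by (auto simp: \<gamma>_def edge_colourings_def PiE_def Pi_def)
      moreover have "restrict (\<gamma>) D = \<tau>"
        using a(3) ga by (auto simp: restrict_def)
      ultimately show "?g p \<in> extensions V D (A \<union> B) s k \<tau>"
        by (simp add: extensions_def flip: \<gamma>_def)
    qed
  qed
  from bij_betw_same_card[OF this] show ?thesis by (simp add: card_cartesian_product)
qed

text \<open>Valid colourings are sorted by their restriction to \<open>D\<close>. An invalid
  \<open>\<tau>\<close> contributes 0, since validity passes to subsets of the edges, so the sum may
  run over all colourings of \<open>D\<close>.\<close>

lemma num_valid_eq_sum_extensions:
  assumes fin: "finite D" "finite A"
  shows "num_valid V (D \<union> A) s k = (\<Sum>\<tau> \<in> edge_colourings D s. card (extensions V D A s k \<tau>))"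
proof -
  have fE: "finite (edge_colourings C s)" if "finite C" for C :: "'a set set"
    using that by (simp add: edge_colourings_def finite_PiE)
  have "{\<sigma> \<in> edge_colourings (D \<union> A) s. valid_colouring V (D \<union> A) s k \<sigma>} =
      (\<Union>\<tau> \<in> edge_colourings D s. extensions V D A s k \<tau>)"
    by (auto simp: extensions_def edge_colourings_def PiE_def Pi_def)
  moreover have "card (\<Union>\<tau> \<in> edge_colourings D s. extensions V D A s k \<tau>) =
      (\<Sum>\<tau> \<in> edge_colourings D s. card (extensions V D A s k \<tau>))"
    by (rule card_UN_disjoint)
      (use fin fE[of D] fE[of "D \<union> A"] in \<open>auto simp: extensions_def\<close>)
  ultimately show ?thesis by (simp add: num_valid_def)
qed

text \<open>Colourings are pulled back along the relabelling \<open>p\<close>. As \<open>p\<close>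
  fixes each edge of \<open>D\<close>, the pullback still extends \<open>\<tau>\<close>. One
  inequality suffices here: \<open>p\<close> is its own inverse, so applying it to the image of
  \<open>A\<close> gives the converse.\<close>

lemma card_extensions_image_le:
  assumes p: "bij_betw p V V" and invol: "\<And>x. p (p x) = x" and D: "\<And>e. e \<in> D \<Longrightarrow> p ` e = e"
    and fin: "finite D" "finite A"
  shows "card (extensions V D A s k \<tau>) \<le> card (extensions V D ((`) p ` A) s k \<tau>)"
proof (rule card_inj_on_le)
  let ?A' = "(`) p ` A"
  let ?h = "\<lambda>\<sigma>. restrict (\<lambda>e. \<sigma> (p ` e)) (D \<union> ?A')"
  have pp: "p ` p ` e = e" for e using invol by (simp add: image_image)
  have DA: "(`) p ` (D \<union> A) = D \<union> ?A'" using D by (auto simp: image_Un)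
  show "inj_on ?h (extensions V D A s k \<tau>)"
  proof (rule inj_onI)
    fix \<sigma> \<rho> assume s: "\<sigma> \<in> extensions V D A s k \<tau>" and r: "\<rho> \<in> extensions V D A s k \<tau>"
      and eq: "?h \<sigma> = ?h \<rho>"
    have "\<sigma> e = \<rho> e" if "e \<in> D \<union> A" for e
    proof -
      have "p ` e \<in> D \<union> ?A'" using that DA by blast
      then show ?thesis using fun_cong[OF eq, of "p ` e"] pp by simp
    qed
    moreover have "\<sigma> \<in> extensional (D \<union> A)" "\<rho> \<in> extensional (D \<union> A)"
      using s r by (auto simp: extensions_def edge_colourings_def PiE_def)
    ultimately show "\<sigma> = \<rho>" using extensionalityI by blast
  qed
  show "finite (extensions V D ?A' s k \<tau>)"
  proof (rule finite_subset)
    show "extensions V D ?A' s k \<tau> \<subseteq> edge_colourings (D \<union> ?A') s" by (auto simp: extensions_def)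
  qed (use fin in \<open>simp add: edge_colourings_def finite_PiE\<close>)
  show "?h ` extensions V D A s k \<tau> \<subseteq> extensions V D ?A' s k \<tau>"
  proof (rule image_subsetI)
    fix \<sigma> assume s: "\<sigma> \<in> extensions V D A s k \<tau>"
    have "valid_colouring V (D \<union> ?A') s k (?h \<sigma>)"
      unfolding valid_colouring_def
    proof (intro ballI notI)
      fix c assume c: "c \<in> {1..s}" "contains_complete V {e \<in> D \<union> ?A'. ?h \<sigma> e = c} (k c)"
      \<comment> \<open>Under \<open>p\<close>, a clique of colour \<open>c\<close> for the pullback
        becomes a clique of colour \<open>c\<close> for \<open>\<sigma>\<close>.\<close>
      have "(`) p ` {e \<in> D \<union> ?A'. ?h \<sigma> e = c} \<subseteq> {e \<in> D \<union> A. \<sigma> e = c}"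
        using pp D by auto
      with contains_complete_mono[OF contains_complete_bij_image[OF p c(2)]]
      have "contains_complete V {e \<in> D \<union> A. \<sigma> e = c} (k c)" by blast
      then show False using s c(1) by (auto simp: extensions_def valid_colouring_def)
    qed
    moreover have "?h \<sigma> \<in> edge_colourings (D \<union> ?A') s"
      using s pp D by (auto simp: extensions_def edge_colourings_def PiE_def Pi_def)
    moreover have "restrict (?h \<sigma>) D = \<tau>"
      using s D by (auto simp: extensions_def restrict_def)
    ultimately show "?h \<sigma> \<in> extensions V D ?A' s k \<tau>" by (simp add: extensions_def)
  qed
qed

lemma card_extensions_image:
  assumes p: "bij_betw p V V" and invol: "\<And>x. p (p x) = x" and D: "\<And>e. e \<in> D \<Longrightarrow> p ` e = e"
    and fin: "finite D" "finite A"
  shows "card (extensions V D ((`) p ` A) s k \<tau>) = card (extensions V D A s k \<tau>)"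
proof (rule antisym)
  have "(`) p ` (`) p ` A = A" using invol by (simp add: image_image)
  then show "card (extensions V D ((`) p ` A) s k \<tau>) \<le> card (extensions V D A s k \<tau>)"
    using card_extensions_image_le[of p V D "(`) p ` A" s k \<tau>, OF p invol] D fin by simp
qed (rule card_extensions_image_le[OF assms])

section \<open>Symmetrisation\<close>

text \<open>The vertex set stays the same: \<open>v\<close> loses its edges and becomes a copy of
  \<open>u\<close>. Writing the new edges as images under a transposition lets
  \<open>card_extensions_image\<close> count their colourings.\<close>

definition clone :: "'a \<Rightarrow> 'a \<Rightarrow> 'a set set \<Rightarrow> 'a set set" where
  "clone u v E = {e \<in> E. v \<notin> e} \<union> (`) (transpose u v) ` {e \<in> E. u \<in> e}"

definition nbhd :: "'a set set \<Rightarrow> 'a \<Rightarrow> 'a set" where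
  "nbhd E x = {y. {x, y} \<in> E}"

lemma simple_graph_edge:
  assumes "simple_graph V E" and "{x, y} \<in> E"
  shows "x \<in> V" "y \<in> V" "x \<noteq> y"
proof -
  have "{x, y} \<in> nsets V 2" using assms unfolding simple_graph_def by blast
  then show "x \<in> V" "y \<in> V" "x \<noteq> y" unfolding doubleton_in_nsets_2 by blast+
qed

lemma nonadjacent_edge:
  assumes "simple_graph V E" and "u \<noteq> v" and "{u, v} \<notin> E" and "e \<in> E" and "u \<in> e"
  shows "v \<notin> e"
proof
  assume "v \<in> e"
  have "card e = 2" "finite e" using assms(1,4) by (auto simp: simple_graph_def nsets_def)
  then have "e = {u, v}" using \<open>v \<in> e\<close> assms(2,5) by (auto simp: card_2_iff)
  then show False using assms(3,4) by simp
qed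

lemma simple_graph_clone:
  assumes g: "simple_graph V E" and "u \<in> V" "v \<in> V"
  shows "simple_graph V (clone u v E)"
proof -
  have "transpose u v ` e \<in> nsets V 2" if "e \<in> nsets V 2" for e
  proof -
    have "transpose u v ` e \<subseteq> V"
      using that assms(2,3) by (auto simp: nsets_def transpose_def)
    then show ?thesis using that by (simp add: nsets_def card_image)
  qed
  then show ?thesis using g by (auto simp: simple_graph_def clone_def)
qed

text \<open>The second formula depends on \<open>x\<close> only through \<open>nbhd E x\<close>, so
  twins other than \<open>v\<close> remain twins.\<close>

lemma nbhd_clone:
  assumes g: "simple_graph V E" and uv: "u \<noteq> v" "{u, v} \<notin> E"
  shows "nbhd (clone u v E) v = nbhd E u"
    and "x \<noteq> v \<Longrightarrow> nbhd (clone u v E) x = nbhd E x - {v} \<union> (if u \<in> nbhd E x then {v} else {})"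
proof -
  have nl: "{a} \<notin> E" for a using simple_graph_edge(3)[OF g, of a a] by auto
  have adj: "{x, y} \<in> clone u v E \<longleftrightarrow> {x, y} \<in> E" if "x \<noteq> v" "y \<noteq> v" for x y
  proof -
    \<comment> \<open>Every transposed edge contains \<open>v\<close>, the image of
      \<open>u\<close>.\<close>
    have "{x, y} \<noteq> transpose u v ` e" if "u \<in> e" for e
      using imageI[OF that, of "transpose u v"] \<open>x \<noteq> v\<close> \<open>y \<noteq> v\<close> by auto
    then show ?thesis using that by (auto simp: clone_def)
  qed
  have adjv: "{v, y} \<in> clone u v E \<longleftrightarrow> {u, y} \<in> E" for y
  proof
    assume "{v, y} \<in> clone u v E"
    then obtain e where e: "e \<in> E" "u \<in> e" "{v, y} = transpose u v ` e"
      by (auto simp: clone_def)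
    have "e = transpose u v ` transpose u v ` e" by (simp add: image_image)
    also have "\<dots> = {u, transpose u v y}" using e(3)[symmetric] by simp
    finally have "{u, transpose u v y} \<in> E" using e(1) by simp
    \<comment> \<open>The case \<open>y = u\<close> would make \<open>u\<close> and \<open>v\<close>
      adjacent, and \<open>y = v\<close> would give a loop at \<open>u\<close>; any other
      \<open>y\<close> is fixed by the transposition.\<close>
    then show "{u, y} \<in> E" using nl uv by (auto simp: transpose_def split: if_splits)
  next
    assume y: "{u, y} \<in> E"
    then have "y \<noteq> u" "y \<noteq> v" using nl uv by auto
    then have "transpose u v ` {u, y} = {v, y}" by simp
    then show "{v, y} \<in> clone u v E" using y unfolding clone_def by blast
  qed
  show "nbhd (clone u v E) v = nbhd E u" by (simp add: nbhd_def adjv)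
  show "nbhd (clone u v E) x = nbhd E x - {v} \<union> (if u \<in> nbhd E x then {v} else {})"
    if "x \<noteq> v"
  proof -
    have "{x, y} \<in> clone u v E \<longleftrightarrow> (if y = v then {x, u} \<in> E else {x, y} \<in> E)" for y
      using adj[OF that, of y] adjv[of x] by (simp add: insert_commute[of x])
    then show ?thesis by (auto simp: nbhd_def)
  qed
qed

text \<open>The three counts are sums over the same colourings of \<open>D\<close>, with summands
  \<open>?a * ?b\<close>, \<open>?a * ?a\<close> and \<open>?b * ?b\<close>, so they can be compared
  term by term.\<close>

lemma num_valid_clone:
  assumes g: "simple_graph V E" and uv: "u \<noteq> v" "{u, v} \<notin> E" "u \<in> V" "v \<in> V"
  shows "2 * num_valid V E s k \<le> num_valid V (clone u v E) s k + num_valid V (clone v u E) s k"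
proof -
  define D where "D = {e \<in> E. u \<notin> e \<and> v \<notin> e}"
  define A where "A = {e \<in> E. u \<in> e}"
  define B where "B = {e \<in> E. v \<in> e}"
  let ?p = "transpose u v"
  have p: "bij_betw ?p V V" using uv by (simp add: bij_betw_transpose_iff)
  have pD: "?p ` e = e" if "e \<in> D" for e
  proof -
    have "?p x = x" if "x \<in> e" for x using that \<open>e \<in> D\<close> by (auto simp: D_def transpose_def)
    then show ?thesis by simp
  qed
  have "finite E"
    using g finite_subset finite_imp_finite_nsets by (auto simp: simple_graph_def)
  then have fin: "finite D" "finite A" "finite B" by (auto simp: D_def A_def B_def)
  have D: "\<And>e. e \<in> D \<Longrightarrow> u \<notin> e \<and> v \<notin> e" by (auto simp: D_def)
  have A: "\<And>e. e \<in> A \<Longrightarrow> u \<in> e \<and> v \<notin> e"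
    using nonadjacent_edge[OF g uv(1,2)] by (auto simp: A_def)
  have B: "\<And>e. e \<in> B \<Longrightarrow> v \<in> e \<and> u \<notin> e"
    using nonadjacent_edge[OF g uv(1,2)] by (auto simp: B_def)
  have mem: "u \<in> ?p ` e \<longleftrightarrow> v \<in> e" "v \<in> ?p ` e \<longleftrightarrow> u \<in> e" for e
    by (simp_all add: in_transpose_image_iff)
  let ?a = "\<lambda>\<tau>. card (extensions V D A s k \<tau>)" and ?b = "\<lambda>\<tau>. card (extensions V D B s k \<tau>)"
  have E: "E = D \<union> (A \<union> B)" by (auto simp: D_def A_def B_def)
  \<comment> \<open>Each clone keeps \<open>D\<close> and the edges at the copied vertex, and
    replaces the edges at the other vertex by a transposed copy of these.\<close>
  have Cu: "clone u v E = D \<union> (A \<union> (`) ?p ` A)"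
    using A by (auto simp: clone_def D_def A_def)
  have Cv: "clone v u E = D \<union> ((`) ?p ` B \<union> B)"
    using B by (auto simp: clone_def D_def B_def transpose_commute)
  have nE: "num_valid V E s k = (\<Sum>\<tau> \<in> edge_colourings D s. ?a \<tau> * ?b \<tau>)"
  proof -
    have "card (extensions V D (A \<union> B) s k \<tau>) = ?a \<tau> * ?b \<tau>" for \<tau>
      by (rule card_extensions_union[OF uv(1)]) (use D A B in blast)+
    then show ?thesis unfolding E using fin by (simp add: num_valid_eq_sum_extensions)
  qed
  have img: "card (extensions V D ((`) ?p ` C) s k \<tau>) = card (extensions V D C s k \<tau>)"
    if "finite C" for C \<tau>
    by (rule card_extensions_image[OF p]) (use pD fin(1) that in auto)
  have nu: "num_valid V (clone u v E) s k = (\<Sum>\<tau> \<in> edge_colourings D s. ?a \<tau> * ?a \<tau>)"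
  proof -
    have A': "v \<in> e \<and> u \<notin> e" if "e \<in> (`) ?p ` A" for e using that A mem by blast
    have "card (extensions V D (A \<union> (`) ?p ` A) s k \<tau>) =
        ?a \<tau> * card (extensions V D ((`) ?p ` A) s k \<tau>)" for \<tau>
      by (rule card_extensions_union[OF uv(1)]) (use D A A' in blast)+
    then show ?thesis unfolding Cu using fin by (simp add: num_valid_eq_sum_extensions img)
  qed
  have nv: "num_valid V (clone v u E) s k = (\<Sum>\<tau> \<in> edge_colourings D s. ?b \<tau> * ?b \<tau>)"
  proof -
    have B': "u \<in> e \<and> v \<notin> e" if "e \<in> (`) ?p ` B" for e using that B mem by blast
    have "card (extensions V D ((`) ?p ` B \<union> B) s k \<tau>) =
        card (extensions V D ((`) ?p ` B) s k \<tau>) * ?b \<tau>" for \<tau>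
      by (rule card_extensions_union[OF uv(1)]) (use D B B' in blast)+
    then show ?thesis unfolding Cv using fin by (simp add: num_valid_eq_sum_extensions img)
  qed
  have amgm: "2 * (a * b) \<le> a * a + b * b" for a b :: nat
  proof -
    \<comment> \<open>Expand the square of a - b, over the integers because subtraction on
      \<open>nat\<close> truncates.\<close>
    have "2 * (int a * int b) \<le> int a * int a + int b * int b"
      using zero_le_square[of "int a - int b"] by (simp add: algebra_simps)
    then show ?thesis by (simp flip: of_nat_mult of_nat_add add: of_nat_le_iff)
  qed
  show ?thesis
    unfolding nE nu nv sum_distrib_left sum.distrib[symmetric] by (rule sum_mono) (rule amgm)
qed

section \<open>Twin classes\<close>

text \<open>The pairs are ordered and include the diagonal, so the cardinality is the sum of the
  squares of the class sizes.\<close>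

definition twins :: "'a set \<Rightarrow> 'a set set \<Rightarrow> ('a \<times> 'a) set" where
  "twins V E = {(x, y) \<in> V \<times> V. nbhd E x = nbhd E y}"

text \<open>Pairs avoiding \<open>v\<close> survive. The vertex \<open>v\<close> leaves its own
  class and joins that of \<open>u\<close>. Since \<open>v\<close> is not its own partner in
  \<open>Cv\<close>, equal class sizes already give a strict gain.\<close>

lemma card_twins_clone:
  assumes g: "simple_graph V E" and uv: "u \<noteq> v" "{u, v} \<notin> E" "u \<in> V" "v \<in> V"
    and ne: "nbhd E u \<noteq> nbhd E v"
    and le: "card {x \<in> V. nbhd E x = nbhd E v} \<le> card {x \<in> V. nbhd E x = nbhd E u}"
  shows "card (twins V E) < card (twins V (clone u v E))"
proof -
  let ?E' = "clone u v E"
  define Cu where "Cu = {x \<in> V. nbhd E x = nbhd E u}"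
  define Cv where "Cv = {x \<in> V - {v}. nbhd E x = nbhd E v}"
  define T where "T = {(x, y) \<in> (V - {v}) \<times> (V - {v}). nbhd E x = nbhd E y}"
  have fV: "finite V" using g by (simp add: simple_graph_def)
  have "T \<subseteq> V \<times> V" by (auto simp: T_def)
  then have "finite T" by (rule finite_subset) (simp add: fV)
  with fV have fin: "finite Cu" "finite Cv" "finite T" by (simp_all add: Cu_def Cv_def)
  have vCu: "v \<notin> Cu" using ne by (simp add: Cu_def)
  \<comment> \<open>The pairs through \<open>v\<close> occur in both orders, which gives the factor
    2; the pair \<open>(v, v)\<close> gives the 1.\<close>
  have sz: "card (T \<union> ({v} \<times> C \<union> C \<times> {v}) \<union> {(v, v)}) = card T + 2 * card C + 1"
    if "finite C" "v \<notin> C" for C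
  proof -
    have "({v} \<times> C) \<inter> (C \<times> {v}) = {}" using that(2) by blast
    then have "card ({v} \<times> C \<union> C \<times> {v}) = card ({v} \<times> C) + card (C \<times> {v})"
      using that(1) by (intro card_Un_disjoint) simp_all
    then have "card ({v} \<times> C \<union> C \<times> {v}) = 2 * card C"
      by (simp add: card_cartesian_product)
    moreover have "card (T \<union> ({v} \<times> C \<union> C \<times> {v})) = card T + card ({v} \<times> C \<union> C \<times> {v})"
    proof (rule card_Un_disjoint)
      show "T \<inter> ({v} \<times> C \<union> C \<times> {v}) = {}" unfolding T_def by blast
    qed (use that fin in simp_all)
    moreover have "card (T \<union> ({v} \<times> C \<union> C \<times> {v}) \<union> {(v, v)}) =
        card (T \<union> ({v} \<times> C \<union> C \<times> {v})) + 1"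
    proof -
      have "(v, v) \<notin> T \<union> ({v} \<times> C \<union> C \<times> {v})" using that(2) unfolding T_def by blast
      then show ?thesis using that(1) fin by simp
    qed
    ultimately show ?thesis by simp
  qed
  have "twins V E = T \<union> ({v} \<times> Cv \<union> Cv \<times> {v}) \<union> {(v, v)}"
    using uv by (auto simp: twins_def T_def Cv_def)
  then have 1: "card (twins V E) = card T + 2 * card Cv + 1"
    using sz[of Cv] fin by (simp add: Cv_def)
  have keep: "nbhd ?E' x = nbhd ?E' y" if "x \<noteq> v" "y \<noteq> v" "nbhd E x = nbhd E y" for x y
    using that nbhd_clone(2)[OF g uv(1,2)] by metis
  \<comment> \<open>Cloning can only add \<open>v\<close> to or remove it from the neighbourhood of
    \<open>x\<close>. Neither happens, because neither \<open>u\<close> nor \<open>v\<close> lies in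
    \<open>nbhd E u\<close>.\<close>
  have toU: "nbhd ?E' x = nbhd ?E' v" if "x \<in> Cu" for x
  proof -
    have "u \<notin> nbhd E u" "v \<notin> nbhd E u"
      using simple_graph_edge(3)[OF g, of u u] uv by (auto simp: nbhd_def)
    moreover have "x \<noteq> v" "nbhd E x = nbhd E u" using that vCu by (auto simp: Cu_def)
    ultimately show ?thesis using nbhd_clone[OF g uv(1,2)] by auto
  qed
  \<comment> \<open>Only an inclusion: classes whose neighbourhoods differed just in
    \<open>v\<close> may merge.\<close>
  have "T \<union> ({v} \<times> Cu \<union> Cu \<times> {v}) \<union> {(v, v)} \<subseteq> twins V ?E'"
    using keep toU uv by (auto simp: twins_def T_def Cu_def)
  moreover have "finite (twins V ?E')"
    by (rule finite_subset[of _ "V \<times> V"]) (use fV in \<open>auto simp: twins_def\<close>)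
  ultimately have 2: "card T + 2 * card Cu + 1 \<le> card (twins V ?E')"
    using sz[OF fin(1) vCu] card_mono by metis
  have "{x \<in> V. nbhd E x = nbhd E v} = insert v Cv" using uv by (auto simp: Cv_def)
  then have "card Cv + 1 \<le> card Cu" using le fin by (simp add: Cu_def[symmetric] Cv_def)
  then show ?thesis using 1 2 by simp
qed

text \<open>The parts are the classes of equal neighbourhood. Adjacent vertices lie in different
  classes because there are no loops; vertices of different classes are adjacent by the
  contrapositive of \<open>tw\<close>.\<close>

lemma complete_multipartiteI:
  assumes g: "simple_graph V E"
    and tw: "\<And>x y. x \<in> V \<Longrightarrow> y \<in> V \<Longrightarrow> x \<noteq> y \<Longrightarrow> {x, y} \<notin> E \<Longrightarrow> nbhd E x = nbhd E y"
  shows "complete_multipartite V E"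
proof -
  define cl where "cl x = {y \<in> V. nbhd E y = nbhd E x}" for x
  have "partition_on V (cl ` V)"
    by (rule partition_onI) (auto simp: cl_def disjnt_def)
  moreover have "E = {{u, v} | u v. \<exists>A \<in> cl ` V. \<exists>B \<in> cl ` V. A \<noteq> B \<and> u \<in> A \<and> v \<in> B}"
  proof (rule set_eqI, rule iffI)
    fix e assume e: "e \<in> E"
    then have "e \<in> nsets V 2" using g by (auto simp: simple_graph_def)
    then obtain x y where xy: "e = {x, y}" "x \<in> V" "y \<in> V" "x \<noteq> y"
      by (auto simp: nsets_def card_2_iff)
    have "y \<in> nbhd E x" "y \<notin> nbhd E y"
      using e xy simple_graph_edge(3)[OF g, of y y] by (auto simp: nbhd_def)
    then have "cl x \<noteq> cl y" "x \<in> cl x" "y \<in> cl y" using xy by (auto simp: cl_def)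
    then show "e \<in> {{u, v} | u v. \<exists>A \<in> cl ` V. \<exists>B \<in> cl ` V. A \<noteq> B \<and> u \<in> A \<and> v \<in> B}"
      using xy by blast
  next
    fix e assume "e \<in> {{u, v} | u v. \<exists>A \<in> cl ` V. \<exists>B \<in> cl ` V. A \<noteq> B \<and> u \<in> A \<and> v \<in> B}"
    then obtain u v a b where e: "e = {u, v}" "cl a \<noteq> cl b" "u \<in> cl a" "v \<in> cl b" by blast
    then have "nbhd E u \<noteq> nbhd E v" "u \<in> V" "v \<in> V" by (auto simp: cl_def)
    then show "e \<in> E" using tw[of u v] e(1) by auto
  qed
  ultimately show ?thesis unfolding complete_multipartite_def by blast
qed

section \<open>Extremal graphs\<close>

lemma num_valid_le_max:
  fixes V :: "nat set"
  assumes "simple_graph V E" and "card V = n"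
  shows "num_valid V E s k \<le> max_num_valid n s k"
proof -
  have "num_valid V E s k \<in> num_valid_values n s k"
    unfolding num_valid_values_def using assms by blast
  then show ?thesis
    unfolding max_num_valid_def by (rule Max_ge[OF finite_num_valid_values])
qed

text \<open>Both clones have counts at most the maximum, yet these sum to at least twice the
  maximum, so both attain it. Hence the vertex to be cloned can be chosen freely.\<close>

lemma extremal_clone:
  fixes V :: "nat set"
  assumes ex: "extremal n s k V E" and uv: "u \<noteq> v" "{u, v} \<notin> E" "u \<in> V" "v \<in> V"
  shows "extremal n s k V (clone u v E)"
proof -
  have g: "simple_graph V E" "card V = n" "num_valid V E s k = max_num_valid n s k"
    using ex by (auto simp: extremal_def)
  have su: "simple_graph V (clone u v E)" and sv: "simple_graph V (clone v u E)"
    using simple_graph_clone[OF g(1)] uv(3,4) by simp_all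
  show ?thesis
    using num_valid_clone[OF g(1) uv, of s k] num_valid_le_max[OF su g(2), of s k]
      num_valid_le_max[OF sv g(2), of s k] g su by (simp add: extremal_def)
qed

theorem theorem2:
  fixes n s :: nat and k :: "nat \<Rightarrow> nat"
  shows "\<exists>(V :: nat set) E. extremal n s k V E \<and> complete_multipartite V E"
proof -
  have "max_num_valid n s k \<in> num_valid_values n s k"
    unfolding max_num_valid_def
    by (rule Max_in[OF finite_num_valid_values num_valid_values_nonempty])
  then obtain V :: "nat set" and E0 where "max_num_valid n s k = num_valid V E0 s k"
    and "simple_graph V E0" and "card V = n"
    unfolding num_valid_values_def by blast
  then have E0: "extremal n s k V E0" by (simp add: extremal_def)
  have fV: "finite V" using E0 by (simp add: extremal_def simple_graph_def)
  \<comment> \<open>Choosing a maximiser with \<open>ex_has_greatest_nat\<close> takes a strict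
    upper bound, hence the \<open>Suc\<close>.\<close>
  have "card (twins V E) < Suc (card (V \<times> V))" for E
    unfolding less_Suc_eq_le
  proof (rule card_mono)
    show "twins V E \<subseteq> V \<times> V" by (auto simp: twins_def)
  qed (use fV in simp)
  \<comment> \<open>The maximum is over extremal edge sets on the fixed \<open>V\<close>, which is
    enough since cloning preserves \<open>V\<close>.\<close>
  then obtain E where E: "extremal n s k V E"
    and max: "\<And>E'. extremal n s k V E' \<Longrightarrow> card (twins V E') \<le> card (twins V E)"
    using ex_has_greatest_nat[where P = "extremal n s k V" and f = "\<lambda>E. card (twins V E)",
        OF E0, of "Suc (card (V \<times> V))"] by blast
  have g: "simple_graph V E" using E by (simp add: extremal_def)
  have "complete_multipartite V E"
  proof (rule complete_multipartiteI[OF g])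
    fix x y assume xy: "x \<in> V" "y \<in> V" "x \<noteq> y" "{x, y} \<notin> E"
    let ?m = "\<lambda>z. card {w \<in> V. nbhd E w = nbhd E z}"
    have yx: "{y, x} \<notin> E" using xy by (simp add: insert_commute)
    show "nbhd E x = nbhd E y"
    proof (rule ccontr)
      assume ne: "nbhd E x \<noteq> nbhd E y"
      \<comment> \<open>The vertex with the larger class is cloned; in either case the result is
        extremal with more twins, against maximality.\<close>
      consider "?m y \<le> ?m x" | "?m x \<le> ?m y" by linarith
      then show False
      proof cases
        case 1
        then show False
          using card_twins_clone[OF g xy(3,4,1,2) ne] max[OF extremal_clone[OF E xy(3,4,1,2)]]
          by simp
      next
        case 2
        then show False
          using card_twins_clone[OF g xy(3)[symmetric] yx xy(2,1) ne[symmetric]]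
            max[OF extremal_clone[OF E xy(3)[symmetric] yx xy(2,1)]]
          by simp
      qed
    qed
  qed
  with E show ?thesis by blast
qed

end
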